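(* Let $p,q\ge 1$ be integers and let $G$ be an interval graph with maximum degree $\Delta$. Let $\sigma=(v_1,v_2,\ldots,v_n)$ be an ordering of the vertices of $G$ such that $r(v_1)\le r(v_2)\le\cdots\le r(v_n)$ in an interval representation of $G$. Then the greedy algorithm described in the context, applied to $(G,\sigma)$, finds an $L(p,q)$-labeling of $G$ with span at most $\max\{p,q\}\Delta$.
   Context: All graphs are finite and simple. For a graph $G=(V,E)$: $N_G(v)$ is the set of neighbors of $v$; $\Delta$ is the maximum degree; $d_G(u,v)$ is the length of a shortest path between $u$ and $v$. An $L(p,q)$-labeling of $G$ is a function $f:V\to\{0,1,2,\dots\}$ with $|f(u)-f(v)|\ge p$ whenever $uv\in E$ and $|f(u)-f(v)|\ge q$ whenever $d_G(u,v)=2$. Its span is the difference between the largest and the smallest label used. $G$ is an interval graph if each vertex $v$ can be assigned a closed interval $I_v$ of the real line so that distinct $u,v$ are adjacent iff $I_u\cap I_v\ne\emptyset$; such an assignment is an interval representation, and $r(v)$ denotes the right endpoint of $I_v$. Greedy algorithm. Start with $S=\emptyset$. For $i=n,n-1,\dots,1$ in this order: find the smallest non-negative integer $j$ such that $j\max\{p,q\}\notin\{f(v): v\in N_G(v_i)\cap S\}\cup\{f(u): u\in S,\ d_G(v_i,u)=2\}$; set $f(v_i)=j\max\{p,q\}$; add $v_i$ to $S$. Output $f$. *)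

theory Defs
  imports "Graph_Theory.Graph_Theory"
begin

text \<open>Finite simple graphs are the library's \<^locale>\<open>graph\<close>: finite symmetric digraphs
  without loops and without parallel arcs. An edge \<open>uv\<close> is a pair of opposite arcs, so
  \<open>uv\<close> is an edge iff \<open>u\<close> dominates \<open>v\<close>, and the degree of a vertex is its out-degree.\<close>

definition neighbors :: "('a, 'b) pre_digraph \<Rightarrow> 'a \<Rightarrow> 'a set" where
  "neighbors G v = {u \<in> verts G. v \<rightarrow>\<^bsub>G\<^esub> u}"

text \<open>Shortest-path length, i.e. minimum cost of a walk under unit arc weights
  (\<open>\<infinity>\<close> if there is no walk).\<close>

definition gdist :: "('a, 'b) pre_digraph \<Rightarrow> 'a \<Rightarrow> 'a \<Rightarrow> ereal" where
  "gdist G u v = wf_digraph.\<mu> G (\<lambda>_. 1) u v"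

text \<open>Maximum degree and span are \<open>0\<close> by convention for the graph without vertices.\<close>

definition max_degree :: "('a, 'b) pre_digraph \<Rightarrow> nat" where
  "max_degree G = (if verts G = {} then 0 else Max (out_degree G ` verts G))"

definition span_of :: "('a, 'b) pre_digraph \<Rightarrow> ('a \<Rightarrow> nat) \<Rightarrow> nat" where
  "span_of G f = (if verts G = {} then 0 else Max (f ` verts G) - Min (f ` verts G))"

definition L_labeling :: "nat \<Rightarrow> nat \<Rightarrow> ('a, 'b) pre_digraph \<Rightarrow> ('a \<Rightarrow> nat) \<Rightarrow> bool" where
  "L_labeling p q G f \<longleftrightarrow>
     (\<forall>u \<in> verts G. \<forall>v \<in> verts G.
        (u \<rightarrow>\<^bsub>G\<^esub> v \<longrightarrow> \<bar>int (f u) - int (f v)\<bar> \<ge> int p) \<and>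
        (gdist G u v = 2 \<longrightarrow> \<bar>int (f u) - int (f v)\<bar> \<ge> int q))"

definition interval_representation ::
    "('a, 'b) pre_digraph \<Rightarrow> ('a \<Rightarrow> real) \<Rightarrow> ('a \<Rightarrow> real) \<Rightarrow> bool" where
  "interval_representation G l r \<longleftrightarrow>
     (\<forall>v \<in> verts G. l v \<le> r v) \<and>
     (\<forall>u \<in> verts G. \<forall>v \<in> verts G. u \<noteq> v \<longrightarrow>
        (u \<rightarrow>\<^bsub>G\<^esub> v \<longleftrightarrow> {l u..r u} \<inter> {l v..r v} \<noteq> {}))"

definition interval_graph :: "('a, 'b) pre_digraph \<Rightarrow> bool" where
  "interval_graph G \<longleftrightarrow> graph G \<and> (\<exists>l r. interval_representation G l r)"

definition greedy_step ::
    "('a, 'b) pre_digraph \<Rightarrow> nat \<Rightarrow> nat \<Rightarrow> 'a \<Rightarrow> 'a set \<times> ('a \<Rightarrow> nat) \<Rightarrow> 'a set \<times> ('a \<Rightarrow> nat)" where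
  "greedy_step G p q v = (\<lambda>(S, f).
     let j = (LEAST j. j * max p q \<notin> f ` (neighbors G v \<inter> S) \<union> f ` {u \<in> S. gdist G v u = 2})
     in (insert v S, f(v := j * max p q)))"

text \<open>\<^const>\<open>foldr\<close> applies the step to the last vertex of the list first. The initial labels
  \<open>0\<close> are placeholders: the step reads labels of already processed vertices only.\<close>

definition greedy :: "('a, 'b) pre_digraph \<Rightarrow> nat \<Rightarrow> nat \<Rightarrow> 'a list \<Rightarrow> 'a \<Rightarrow> nat" where
  "greedy G p q \<sigma> = snd (foldr (greedy_step G p q) \<sigma> ({}, \<lambda>_. 0))"

end

theory Submission
  imports Defs
begin

text \<open>When \<open>v\<close> is labelled, the processed vertices are those ending no earlier than \<open>v\<close>. Let \<open>w\<close> be a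
  neighbour of \<open>v\<close> with the largest right endpoint. Every processed neighbour of \<open>v\<close> contains \<open>r v\<close>,
  and every processed vertex at distance two starts after \<open>r v\<close> but no later than \<open>r w\<close>. If there are
  vertices of the latter kind, \<open>w\<close> contains \<open>r v\<close> too and is adjacent to all of these vertices and to
  \<open>v\<close>, so at most \<open>out_degree G w\<close> labels are forbidden; otherwise only neighbours of \<open>v\<close> forbid
  labels. Either way a multiple of \<open>max p q\<close> among the first \<open>\<Delta> + 1\<close> ones is free.\<close>

text \<open>Distinct multiples of \<open>max p q\<close> respect the gap \<open>p\<close> as well as
  the gap \<open>q\<close>, so adjacency and distance two need not be told apart.\<close>

definition conflicts :: "('a, 'b) pre_digraph \<Rightarrow> 'a \<Rightarrow> 'a set" where
  "conflicts G v = neighbors G v \<union> {u. gdist G v u = 2}"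

text \<open>Under unit weights a walk costs its length, so the right-hand side says that lengths 0
  and 1 are impossible and length 2 occurs. The empty walk at \<open>u\<close> exists because
  \<open>u\<close> is a vertex.\<close>

lemma (in wf_digraph) gdist_eq_2_iff:
  assumes "u \<in> verts G"
  shows "gdist G u v = 2 \<longleftrightarrow> u \<noteq> v \<and> \<not> u \<rightarrow> v \<and> (\<exists>w. u \<rightarrow> w \<and> w \<rightarrow> v)"
proof -
  have edge: "x \<rightarrow> y \<longleftrightarrow> (\<exists>e. awalk x [e] y)" for x y
    by (auto simp: arcs_ends_conv awalk_simps)
  have two_edges: "(\<exists>w. u \<rightarrow> w \<and> w \<rightarrow> v) \<longleftrightarrow> (\<exists>e e'. awalk u [e, e'] v)"
    by (force simp: arcs_ends_conv awalk_simps)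
  have cost: "awalk_cost (\<lambda>_. 1) es = length es" for es :: "'b list"
    by (induction es) auto
  have dist: "gdist G u v = (INF es\<in>{es. awalk u es v}. ereal (length es))"
    by (simp add: gdist_def \<mu>_def cost)
  show ?thesis
  proof
    assume gdist_2: "gdist G u v = 2"
    have long: "length es \<ge> 2" if "awalk u es v" for es
    proof -
      have "gdist G u v \<le> ereal (length es)"
        unfolding dist using that by (intro INF_lower) simp
      then have "ereal 2 \<le> ereal (length es)" using gdist_2 by simp
      then show ?thesis by simp
    qed
    have "u \<noteq> v" using long[of "[]"] assms by (auto simp: awalk_simps)
    moreover have "\<not> u \<rightarrow> v" using long unfolding edge by fastforce
    moreover have "\<exists>e e'. awalk u [e, e'] v"
    \<comment> \<open>An infimum alone provides no walk. But lengths are integers, so without a walk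
      of length 2 the infimum is at least 3, or infinite if there is no walk at all.\<close>
    proof (rule ccontr)
      assume none: "\<nexists>e e'. awalk u [e, e'] v"
      have "length es \<ge> 3" if "awalk u es v" for es
      proof (rule ccontr)
        assume "\<not> length es \<ge> 3"
        with long[OF that] have "length es = 2" by simp
        then obtain e e' where "es = [e, e']"
          by (auto simp: length_Suc_conv numeral_2_eq_2)
        with that none show False by blast
      qed
      then have "ereal 3 \<le> gdist G u v"
        unfolding dist by (intro INF_greatest) auto
      then show False using gdist_2 by simp
    qed
    ultimately show "u \<noteq> v \<and> \<not> u \<rightarrow> v \<and> (\<exists>w. u \<rightarrow> w \<and> w \<rightarrow> v)"
      by (simp add: two_edges)
  next
    assume R: "u \<noteq> v \<and> \<not> u \<rightarrow> v \<and> (\<exists>w. u \<rightarrow> w \<and> w \<rightarrow> v)"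
    then obtain e e' where walk: "awalk u [e, e'] v" using two_edges by blast
    have "length es \<ge> 2" if "awalk u es v" for es
    proof (rule ccontr)
      assume "\<not> length es \<ge> 2"
      then have "es = [] \<or> (\<exists>e. es = [e])"
        by (auto simp: not_le less_2_cases_iff length_Suc_conv)
      with that R show False unfolding edge by (auto simp: awalk_Nil_iff)
    qed
    then have "ereal 2 \<le> gdist G u v"
      unfolding dist by (intro INF_greatest) auto
    moreover have "gdist G u v \<le> ereal (length [e, e'])"
      unfolding dist using walk by (intro INF_lower) simp
    ultimately show "gdist G u v = 2" by (auto intro: antisym)
  qed
qed

lemma (in graph) adj_sym: "u \<rightarrow> v \<Longrightarrow> v \<rightarrow> u"
  using sym_arcs by (auto simp: symmetric_def dest: symD)

lemma (in graph) gdist_eq_2_sym: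
  assumes "u \<in> verts G" "v \<in> verts G" "gdist G u v = 2"
  shows "gdist G v u = 2"
  using assms adj_sym by (metis gdist_eq_2_iff)

lemma (in graph) conflicts_sym:
  assumes "u \<in> verts G" "v \<in> verts G" "u \<in> conflicts G v"
  shows "v \<in> conflicts G u"
  using assms adj_sym gdist_eq_2_sym unfolding conflicts_def neighbors_def by blast

lemma (in graph) not_in_conflicts_self:
  assumes "v \<in> verts G"
  shows "v \<notin> conflicts G v"
  using assms adj_not_same gdist_eq_2_iff unfolding conflicts_def neighbors_def by blast

lemma (in graph) finite_neighbors [simp]: "finite (neighbors G v)"
  by (simp add: neighbors_def)

lemma (in graph) card_neighbors_le_max_degree:
  assumes "v \<in> verts G"
  shows "card (neighbors G v) \<le> max_degree G"
proof -
  have "neighbors G v \<subseteq> head G ` out_arcs G v"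
    by (auto simp: neighbors_def arcs_ends_conv)
  then have "card (neighbors G v) \<le> out_degree G v"
    unfolding out_degree_def using finite_out_arcs surj_card_le by blast
  also have "\<dots> \<le> max_degree G"
    using assms by (auto simp: max_degree_def)
  finally show ?thesis .
qed

text \<open>Given the two inequalities, the larger left endpoint lies in both intervals, as neither
  is empty.\<close>

lemma interval_representation_adj_iff:
  assumes "interval_representation G l r" "u \<in> verts G" "v \<in> verts G" "u \<noteq> v"
  shows "u \<rightarrow>\<^bsub>G\<^esub> v \<longleftrightarrow> l u \<le> r v \<and> l v \<le> r u"
proof -
  have "l u \<le> r u" "l v \<le> r v"
    using assms by (auto simp: interval_representation_def)
  moreover have "u \<rightarrow>\<^bsub>G\<^esub> v \<longleftrightarrow> {l u..r u} \<inter> {l v..r v} \<noteq> {}"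
    using assms unfolding interval_representation_def by blast
  ultimately show ?thesis by auto
qed

lemma (in graph) card_conflicts_le_max_degree:
  assumes rep: "interval_representation G l r"
    and v: "v \<in> verts G" and S: "S \<subseteq> verts G" and r_min: "\<And>u. u \<in> S \<Longrightarrow> r v \<le> r u"
  shows "card (conflicts G v \<inter> S) \<le> max_degree G"
proof (cases "\<exists>u\<in>S. gdist G v u = 2")
  case False
  then have "card (conflicts G v \<inter> S) \<le> card (neighbors G v)"
    by (intro card_mono) (auto simp: conflicts_def)
  also have "\<dots> \<le> max_degree G" by (rule card_neighbors_le_max_degree[OF v])
  finally show ?thesis .
next
  case True
  note adj_iff = interval_representation_adj_iff[OF rep]
  have between: "r v < l u \<and> (\<exists>w\<in>neighbors G v. l u \<le> r w)"
    if u: "u \<in> S" "gdist G v u = 2" for u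
  proof -
    obtain w where w: "u \<noteq> v" "\<not> v \<rightarrow> u" "v \<rightarrow> w" "w \<rightarrow> u"
      using u(2) gdist_eq_2_iff[OF v] by blast
    have verts: "u \<in> verts G" "w \<in> verts G" using w adj_in_verts by blast+
    have "w \<noteq> u" using w by blast
    \<comment> \<open>Here \<open>l v \<le> r v \<le> r u\<close>, so non-adjacency can only come
      from \<open>u\<close> starting after \<open>v\<close> ends.\<close>
    have "l v \<le> r v" using rep v by (simp add: interval_representation_def)
    then have "r v < l u"
      using adj_iff[OF v verts(1)] w r_min[OF u(1)] by auto
    moreover have "l u \<le> r w"
      using adj_iff[OF verts(2,1) \<open>w \<noteq> u\<close>] w by simp
    ultimately show ?thesis using w verts by (auto simp: neighbors_def)
  qed
  have "neighbors G v \<noteq> {}" using True between by blast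
  then have "Max (r ` neighbors G v) \<in> r ` neighbors G v" by (intro Max_in) simp_all
  \<comment> \<open>Different vertices at distance two may have different middle vertices; the
    neighbour reaching farthest right serves for all of them.\<close>
  then obtain w where w: "w \<in> neighbors G v" and "r w = Max (r ` neighbors G v)" by auto
  then have w_max: "\<And>x. x \<in> neighbors G v \<Longrightarrow> r x \<le> r w" by simp
  have wG: "w \<in> verts G" and vw: "v \<rightarrow> w" using w by (auto simp: neighbors_def)
  have "v \<noteq> w" using vw adj_not_same by blast
  \<comment> \<open>\<open>w\<close> need not lie in \<open>S\<close>, so \<open>r_min\<close> does
    not apply. A vertex \<open>u\<close> at distance two gives \<open>r v < l u \<le> r w\<close>
    instead.\<close>
  have "r v \<le> r w" using True between w_max by force
  have "l w \<le> r v" using adj_iff[OF v wG \<open>v \<noteq> w\<close>] vw by simp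
  \<comment> \<open>\<open>w\<close> may be a conflict of \<open>v\<close> but is no neighbour of
    itself. Exchanging it for \<open>v\<close> keeps the count from dropping, so the bound is the
    degree of \<open>w\<close> without an extra 1.\<close>
  have "insert v (conflicts G v \<inter> S - {w}) \<subseteq> neighbors G w"
  proof
    fix u assume "u \<in> insert v (conflicts G v \<inter> S - {w})"
    then consider "u = v" | "u \<in> S" "u \<noteq> w" "v \<rightarrow> u" | "u \<in> S" "u \<noteq> w" "gdist G v u = 2"
      by (auto simp: conflicts_def neighbors_def)
    then show "u \<in> neighbors G w"
    proof cases
      case 1
      then show ?thesis using adj_sym[OF vw] v by (simp add: neighbors_def)
    next
      case 2
      have uG: "u \<in> verts G" and "v \<noteq> u" using 2 S adj_not_same by auto
      then have "l u \<le> r v" using adj_iff[OF v uG] 2 by simp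
      then show ?thesis
        using adj_iff[OF wG uG] 2 uG r_min[OF 2(1)] \<open>l w \<le> r v\<close> \<open>r v \<le> r w\<close>
        by (auto simp: neighbors_def)
    next
      case 3
      have uG: "u \<in> verts G" using 3 S by auto
      have "l u \<le> r w" using between[OF 3(1,3)] w_max by force
      then show ?thesis
        using adj_iff[OF wG uG] 3 uG r_min[OF 3(1)] \<open>l w \<le> r v\<close>
        by (auto simp: neighbors_def)
    qed
  qed
  then have "card (insert v (conflicts G v \<inter> S - {w})) \<le> card (neighbors G w)"
    by (intro card_mono) simp_all
  moreover have "finite (conflicts G v \<inter> S)" using finite_subset[OF S] by simp
  moreover have "v \<notin> conflicts G v \<inter> S" using not_in_conflicts_self[OF v] by blast
  ultimately have "card (conflicts G v \<inter> S) \<le> card (neighbors G w)"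
    by (auto simp: card_Diff_singleton_if split: if_splits)
  also have "\<dots> \<le> max_degree G" by (rule card_neighbors_le_max_degree[OF wG])
  finally show ?thesis .
qed

text \<open>Pigeonhole: for \<open>m > 0\<close> the multiples of \<open>m\<close> by
  \<open>0, ..., card A\<close> are \<open>card A + 1\<close> distinct numbers, so one of them
  avoids \<open>A\<close>.\<close>

lemma Least_multiple_notin:
  fixes A :: "nat set" and m :: nat
  assumes "finite A" "m > 0"
  defines "j \<equiv> LEAST j. j * m \<notin> A"
  shows "j * m \<notin> A" "j \<le> card A"
proof -
  have "\<exists>k \<le> card A. k * m \<notin> A"
  proof (rule ccontr)
    assume "\<not> ?thesis"
    then have "(\<lambda>k. k * m) ` {..card A} \<subseteq> A" by auto
    then have "card ((\<lambda>k. k * m) ` {..card A}) \<le> card A"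
      by (rule card_mono[OF assms(1)])
    moreover have "inj_on (\<lambda>k. k * m) {..card A}" using assms(2) by (auto simp: inj_on_def)
    ultimately show False by (simp add: card_image)
  qed
  then obtain k where "k \<le> card A" "k * m \<notin> A" by blast
  then show "j * m \<notin> A" "j \<le> card A"
    unfolding j_def by (metis (mono_tags, lifting) LeastI, metis (mono_tags, lifting) Least_le order_trans)
qed

lemma fst_foldr_greedy_step:
  "fst (foldr (greedy_step G p q) xs s) = set xs \<union> fst s"
  by (induction xs) (auto simp: greedy_step_def case_prod_beta Let_def)

text \<open>\<open>foldr\<close> handles the tail first, so the processed set on reaching
  \<open>v\<close> is \<open>set xs\<close>. This removes the state and allows plain list
  induction.\<close>

lemma greedy_Cons:
  "greedy G p q (v # xs) = (greedy G p q xs)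
     (v := (LEAST j. j * max p q \<notin> greedy G p q xs ` (conflicts G v \<inter> set xs)) * max p q)"
proof -
  have "conflicts G v \<inter> set xs = neighbors G v \<inter> set xs \<union> {u \<in> set xs. gdist G v u = 2}"
    by (auto simp: conflicts_def)
  then show ?thesis
    by (simp add: greedy_def greedy_step_def case_prod_beta Let_def fst_foldr_greedy_step image_Un)
qed

text \<open>Stated for arbitrary sorted lists so that induction passes to tails; sortedness makes
  the head end first. Divisibility is recorded to turn distinct labels into distant ones
  later.\<close>

lemma (in graph) greedy_invariant:
  assumes rep: "interval_representation G l r" and pos: "max p q > 0"
    and "distinct xs" "set xs \<subseteq> verts G" "sorted (map r xs)"
  shows "(\<forall>v \<in> set xs. max p q dvd greedy G p q xs v \<and> greedy G p q xs v \<le> max p q * max_degree G) \<and>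
         (\<forall>u \<in> set xs. \<forall>v \<in> set xs. u \<in> conflicts G v \<longrightarrow> greedy G p q xs u \<noteq> greedy G p q xs v)"
  using assms(3-)
proof (induction xs)
  case Nil
  then show ?case by simp
next
  case (Cons v xs)
  define f where "f = greedy G p q xs"
  define A where "A = f ` (conflicts G v \<inter> set xs)"
  define j where "j = (LEAST j. j * max p q \<notin> A)"
  have step: "greedy G p q (v # xs) = f(v := j * max p q)"
    by (simp add: greedy_Cons f_def A_def j_def)
  have IH: "\<And>u. u \<in> set xs \<Longrightarrow> max p q dvd f u \<and> f u \<le> max p q * max_degree G"
    "\<And>u w. u \<in> set xs \<Longrightarrow> w \<in> set xs \<Longrightarrow> u \<in> conflicts G w \<Longrightarrow> f u \<noteq> f w"
    using Cons by (auto simp: f_def)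
  have v: "v \<in> verts G" and xs: "set xs \<subseteq> verts G" and "v \<notin> set xs" using Cons.prems by auto
  have fin: "finite A" by (simp add: A_def)
  have "j \<le> card A" unfolding j_def by (rule Least_multiple_notin(2)[OF fin pos])
  \<comment> \<open>Conflicting vertices may share a label, which only helps.\<close>
  also have "\<dots> \<le> card (conflicts G v \<inter> set xs)"
    unfolding A_def by (rule card_image_le) simp
  also have "\<dots> \<le> max_degree G"
    using card_conflicts_le_max_degree[OF rep v xs] Cons.prems(3) by auto
  finally have bound: "j \<le> max_degree G" .
  have "j * max p q \<notin> A" unfolding j_def by (rule Least_multiple_notin(1)[OF fin pos])
  then have new: "f u \<noteq> j * max p q" if "u \<in> set xs" "u \<in> conflicts G v" for u
    using that unfolding A_def by (metis IntI imageI)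
  \<comment> \<open>The invariant ranges over ordered pairs, so \<open>v\<close> must also be
    treated on the other side.\<close>
  have new': "f u \<noteq> j * max p q" if "u \<in> set xs" "v \<in> conflicts G u" for u
    using that new conflicts_sym v xs by blast
  have "\<forall>u \<in> set (v # xs). max p q dvd (f(v := j * max p q)) u \<and>
      (f(v := j * max p q)) u \<le> max p q * max_degree G"
    using IH(1) bound by (auto simp: mult.commute)
  moreover have "\<forall>u \<in> set (v # xs). \<forall>w \<in> set (v # xs). u \<in> conflicts G w \<longrightarrow>
      (f(v := j * max p q)) u \<noteq> (f(v := j * max p q)) w"
    using IH(2) new new' not_in_conflicts_self[OF v] \<open>v \<notin> set xs\<close> by (auto dest: sym)
  ultimately show ?case unfolding step by blast
qed

text \<open>The difference is a nonzero multiple of \<open>m\<close>.\<close>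

lemma dvd_imp_le_abs_diff:
  fixes a b m :: nat
  assumes "m dvd a" "m dvd b" "a \<noteq> b"
  shows "int m \<le> \<bar>int a - int b\<bar>"
proof -
  have "int m dvd int a - int b" using assms by (simp add: dvd_diff)
  then show ?thesis using assms dvd_imp_le_int[of "int a - int b" "int m"] by simp
qed

theorem theorem9:
  fixes G :: "('a, 'b) pre_digraph"
    and p q :: nat
    and l r :: "'a \<Rightarrow> real"
    and \<sigma> :: "'a list"
  assumes "p \<ge> 1" and "q \<ge> 1"
    and "interval_graph G"
    and "distinct \<sigma>" and "set \<sigma> = verts G"
    and "interval_representation G l r"
    and "sorted (map r \<sigma>)"
  shows "L_labeling p q G (greedy G p q \<sigma>) \<and>
         span_of G (greedy G p q \<sigma>) \<le> max p q * max_degree G"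
proof -
  interpret graph G using assms(3) by (simp add: interval_graph_def)
  define f where "f = greedy G p q \<sigma>"
  have f: "max p q dvd f v" "f v \<le> max p q * max_degree G" if "v \<in> verts G" for v
    using greedy_invariant[OF assms(6), of p q \<sigma>] assms that by (auto simp: f_def)
  have f_conflict: "f u \<noteq> f v" if "u \<in> verts G" "v \<in> verts G" "v \<in> conflicts G u" for u v
    using greedy_invariant[OF assms(6), of p q \<sigma>] assms that unfolding f_def by fastforce
  have "int (max p q) \<le> \<bar>int (f u) - int (f v)\<bar>"
    if "u \<in> verts G" "v \<in> verts G" "v \<in> conflicts G u" for u v
    using that f f_conflict by (intro dvd_imp_le_abs_diff) auto
  then have "L_labeling p q G f"
    by (force simp: L_labeling_def conflicts_def neighbors_def)
  moreover have "span_of G f \<le> max p q * max_degree G"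
  proof (cases "verts G = {}")
    case True
    then show ?thesis by (simp add: span_of_def)
  next
    case False
    \<comment> \<open>Subtracting the smallest label only lowers the span, so bounding the largest
      one suffices.\<close>
    then have "Max (f ` verts G) \<le> max p q * max_degree G" using f(2) by simp
    then show ?thesis by (simp add: span_of_def le_diff_conv trans_le_add1)
  qed
  ultimately show ?thesis by (simp add: f_def)
qed

end
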